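(* For every integer $n\ge1$, the second factorial moment of the area statistic on parking functions of length $n$ is $$-\frac{7}{3}(n+1)\,E_1(n)+\frac{5}{12}n^3-\frac{1}{12}n^2-\frac13 n,$$ and asymptotically, as $n\to\infty$, it equals $\frac{5}{12}n^3+O(n^{5/2})$.
   Context: A parking function of length $n$ is a vector of positive integers $(p_1,\dots,p_n)$, $1\le p_i\le n$, whose non-decreasing rearrangement satisfies $p_{(i)}\le i$ for $1\le i\le n$; there are $(n+1)^{n-1}$ of them. The area statistic is $\mathrm{Area}(p)=\frac{n(n+1)}{2}-\sum_{i=1}^n p_i$. Choose $p$ uniformly at random among parking functions of length $n$; the $k$-th factorial moment of the area is $E[A(A-1)\cdots(A-k+1)]$ with $A=\mathrm{Area}(p)$, and $E_1(n)=E[A]$ is its expectation. *)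

theory Defs
  imports "HOL-Probability.Probability" "HOL-Library.Landau_Symbols"
begin

text \<open>List positions are counted from 0, so the condition \<open>p\<^sub>(\<^sub>i\<^sub>) \<le> i\<close> on the non-decreasing
  rearrangement reads \<open>sort p ! i \<le> Suc i\<close>.\<close>

definition parking_functions :: "nat \<Rightarrow> nat list set" where
  "parking_functions n =
     {p. length p = n \<and> (\<forall>i<n. 1 \<le> p ! i \<and> p ! i \<le> n) \<and> (\<forall>i<n. sort p ! i \<le> Suc i)}"

text \<open>The area is real-valued, so that neither the division nor the subtraction truncates.\<close>

definition area :: "nat list \<Rightarrow> real" where
  "area p = real (length p) * (real (length p) + 1) / 2 - (\<Sum>i<length p. real (p ! i))"

text \<open>\<^const>\<open>pmf_of_set\<close> is the uniform distribution only on finite nonempty sets.\<close>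

lemma finite_parking_functions: "finite (parking_functions n)"
proof (rule finite_subset)
  show "parking_functions n \<subseteq> {p. set p \<subseteq> {..n} \<and> length p = n}"
    by (auto simp: parking_functions_def in_set_conv_nth)
  show "finite {p. set p \<subseteq> {..n} \<and> length p = n}"
    by (rule finite_lists_length_eq) simp
qed

lemma parking_functions_nonempty: "parking_functions n \<noteq> {}"
proof -
  have "sort (replicate n (1::nat)) = replicate n 1"
    by (rule sorted_sort_id) simp
  then have "replicate n 1 \<in> parking_functions n"
    by (auto simp: parking_functions_def)
  then show ?thesis by blast
qed

definition area_expectation :: "nat \<Rightarrow> real" where
  "area_expectation n = measure_pmf.expectation (pmf_of_set (parking_functions n)) area"

definition area_factorial_moment :: "nat \<Rightarrow> nat \<Rightarrow> real" where
  "area_factorial_moment k n =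
     measure_pmf.expectation (pmf_of_set (parking_functions n)) (\<lambda>p. \<Prod>j<k. area p - real j)"

end

theory Submission
  imports Defs "HOL-Computational_Algebra.Formal_Power_Series"
begin

text \<open>
  Replacing each entry \<open>v\<close> by \<open>v - 1\<close> turns parking functions into maps on an index set that satisfy a
  counting condition. That condition makes sense for an index set \<open>A\<close> and a bound \<open>s\<close> that are unrelated;
  parking functions of length \<open>n\<close> are the case \<open>card A = n\<close>, \<open>s = n + 1\<close>. The extra freedom gives a
  recursion in \<open>s\<close> alone: deleting the indices with value 0 and lowering the other values by 1
  turns a map for \<open>(A, s + 1)\<close>, where \<open>card A \<le> s\<close>, into a map for \<open>(B, s)\<close>, where \<open>B \<subseteq> A\<close> is arbitrary, and lowers the total of
  the values by \<open>card B\<close> (\<open>sum_parking_maps_Suc\<close>).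

  Let \<open>F\<^sub>s(x, t)\<close> be the exponential generating function, in \<open>x\<close> marking \<open>card A\<close>, of the sums of
  \<open>e\<close> to the power \<open>t \<cdot> total\<close>. In the degrees
  up to \<open>s\<close> the recursion reads \<open>F\<^sub>s\<^sub>+\<^sub>1(x, t) = e\<^sup>x F\<^sub>s(e\<^sup>t x, t)\<close>, which has the solutions
  \<open>exp(x (1 + e\<^sup>t + \<dots> + e\<^sup>(\<^sup>s\<^sup>-\<^sup>1\<^sup>)\<^sup>t)) w(e\<^sup>s\<^sup>t x, t)\<close> where \<open>w\<close> does not involve \<open>s\<close>. Since there is no
  map when \<open>card A = s \<ge> 1\<close>, the coefficients of \<open>x\<^sup>s\<close> in \<open>F\<^sub>s\<close> vanish, and this determines \<open>w\<close>.
  Up to second order in \<open>t\<close> it turns out to be rational in \<open>x\<close>, with denominator a power of \<open>1 - x\<close>. So the moments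
  of order 0, 1, 2 of the total are \<open>n!\<close> times the coefficient of \<open>x\<^sup>n\<close> in \<open>e\<^sup>s\<^sup>x r(x)\<close> for
  explicit rational functions \<open>r\<close> (\<open>total_moment_eq_egf_coeff\<close>).

  Such coefficients are linearly dependent, because the coefficient of \<open>x\<^sup>n\<close> in \<open>(x d/dx - n) F\<close> is always
  zero; with \<open>F = e\<^sup>s\<^sup>x g\<close> this is \<open>egf_coeff_exp_derivation\<close>. A suitable \<open>g\<close> at
  \<open>s = n\<close> confirms the vanishing on the diagonal, and another one at \<open>s = n + 1\<close> gives the linear
  relation between the three moments that is the exact formula (\<open>moment_relation\<close>).

  The asymptotic statement needs only \<open>E\<^sub>1(n) = O(n\<^sup>3\<^sup>/\<^sup>2)\<close>, and the exact formula provides this bound itself: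
  \<open>E\<^sub>1(n) \<ge> 0\<close> enters the second moment with a negative coefficient, so the second moment is at most
  \<open>5/12 n\<^sup>3\<close>, and by Cauchy-Schwarz it is at least \<open>E\<^sub>1(n)\<^sup>2\<close>.
\<close>

section \<open>Parking maps with a variable bound\<close>

text \<open>In terms of the non-decreasing rearrangement \<open>q\<close> of the values, indexed from 0 and with \<open>n = card A\<close>, the condition
  is \<open>q\<^sub>i + n < s + i\<close>. Counting the values that reach \<open>s - j\<close> avoids sorting, and writing
  \<open>s \<le> f i + j\<close> avoids truncated subtraction when \<open>j > s\<close>.\<close>

definition parks :: "'a set \<Rightarrow> nat \<Rightarrow> ('a \<Rightarrow> nat) \<Rightarrow> bool" where
  "parks A s f \<longleftrightarrow> (\<forall>j\<ge>1. card {i \<in> A. s \<le> f i + j} < j)"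

definition parking_maps :: "'a set \<Rightarrow> nat \<Rightarrow> ('a \<Rightarrow> nat) set" where
  "parking_maps A s = {f \<in> A \<rightarrow>\<^sub>E UNIV. parks A s f}"

lemma parks_cong: "(\<And>i. i \<in> A \<Longrightarrow> f i = g i) \<Longrightarrow> parks A s f = parks A s g"
  unfolding parks_def by (simp cong: conj_cong)

lemma parks_less:
  assumes "finite A" "parks A s f" "i \<in> A"
  shows "Suc (f i) < s"
proof (rule ccontr)
  assume "\<not> Suc (f i) < s"
  then have "i \<in> {i \<in> A. s \<le> f i + 1}" using assms by auto
  moreover have "card {i \<in> A. s \<le> f i + 1} < 1"
    using assms(2) unfolding parks_def by blast
  ultimately show False using assms(1) by auto
qed

lemma finite_parking_maps:
  assumes "finite A"
  shows "finite (parking_maps A s)"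
proof (rule finite_subset)
  show "parking_maps A s \<subseteq> A \<rightarrow>\<^sub>E {..<s}"
  proof
    fix f assume "f \<in> parking_maps A s"
    then have "f \<in> extensional A" "parks A s f"
      by (auto simp: parking_maps_def PiE_def)
    moreover have "f i < s" if "i \<in> A" for i
      using parks_less[OF assms \<open>parks A s f\<close> that] by simp
    ultimately show "f \<in> A \<rightarrow>\<^sub>E {..<s}"
      by (simp add: PiE_iff)
  qed
  show "finite (A \<rightarrow>\<^sub>E {..<s})"
    using assms by (intro finite_PiE) auto
qed

lemma parking_maps_diagonal:
  assumes "finite A" "A \<noteq> {}"
  shows "parking_maps A (card A) = {}"
proof -
  have "\<not> parks A (card A) f" for f
  proof
    assume "parks A (card A) f"
    moreover have "card A \<ge> 1" using assms by (simp add: Suc_le_eq card_gt_0_iff)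
    ultimately have "card {i \<in> A. card A \<le> f i + card A} < card A"
      unfolding parks_def by blast
    then show False by simp
  qed
  then show ?thesis by (simp add: parking_maps_def)
qed

lemma parking_maps_empty: "parking_maps {} s = {\<lambda>_. undefined}"
  by (auto simp: parking_maps_def parks_def)

text \<open>Indices with value 0 are never counted for \<open>j \<le> s\<close>, and for \<open>j > s\<close> there are too few
  indices for either condition to fail.\<close>

lemma parks_Suc_iff:
  assumes "finite A" "card A \<le> s"
  shows "parks A (Suc s) f \<longleftrightarrow> parks {i \<in> A. 0 < f i} s (\<lambda>i. f i - 1)"
proof -
  let ?B = "{i \<in> A. 0 < f i}"
  have "card {i \<in> A. Suc s \<le> f i + j} < j \<longleftrightarrow> card {i \<in> ?B. s \<le> f i - 1 + j} < j" for j
  proof (cases "j \<le> s")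
    case True
    then have "{i \<in> A. Suc s \<le> f i + j} = {i \<in> ?B. s \<le> f i - 1 + j}" by auto
    then show ?thesis by simp
  next
    case False
    have "card {i \<in> A. Suc s \<le> f i + j} \<le> card A" "card {i \<in> ?B. s \<le> f i - 1 + j} \<le> card A"
      using assms(1) by (auto intro!: card_mono)
    then show ?thesis using False assms(2) by simp
  qed
  then show ?thesis by (simp add: parks_def)
qed

text \<open>A map for the bound \<open>s + 1\<close> is determined by the set \<open>B\<close> of indices with positive value and by
  its values on \<open>B\<close> lowered by 1.\<close>

lemma sum_parking_maps_Suc:
  fixes \<phi> :: "nat \<Rightarrow> real"
  assumes A: "finite A" "card A \<le> s"
  shows "(\<Sum>f\<in>parking_maps A (Suc s). \<phi> (\<Sum>i\<in>A. f i)) =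
     (\<Sum>B\<in>Pow A. \<Sum>g\<in>parking_maps B s. \<phi> (card B + (\<Sum>i\<in>B. g i)))"
proof -
  \<comment> \<open>\<open>?down\<close> discards the zeros and lowers the rest; \<open>?up\<close> is its inverse.\<close>
  let ?down = "\<lambda>f. ({i \<in> A. 0 < f i}, \<lambda>i\<in>{i \<in> A. 0 < f i}. f i - 1)"
  let ?up = "\<lambda>(B, g). \<lambda>i\<in>A. if i \<in> B then Suc (g i) else 0"
  have "(\<Sum>f\<in>parking_maps A (Suc s). \<phi> (\<Sum>i\<in>A. f i)) =
     (\<Sum>(B, g)\<in>Sigma (Pow A) (\<lambda>B. parking_maps B s). \<phi> (card B + (\<Sum>i\<in>B. g i)))"
  proof (rule sum.reindex_bij_witness[where i = ?up and j = ?down])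
    fix f assume f: "f \<in> parking_maps A (Suc s)"
    let ?B = "{i \<in> A. 0 < f i}"
    show "?up (?down f) = f"
      using f by (auto simp: parking_maps_def PiE_def extensional_def fun_eq_iff)
    have "parks ?B s (\<lambda>i. f i - 1)"
      using f by (simp add: parking_maps_def parks_Suc_iff[OF A])
    then have "parks ?B s (\<lambda>i\<in>?B. f i - 1)"
      by (subst parks_cong[where g = "\<lambda>i. f i - 1"]) auto
    then show "?down f \<in> Sigma (Pow A) (\<lambda>B. parking_maps B s)"
      by (auto simp: parking_maps_def)
    have "card ?B + (\<Sum>i\<in>?B. (\<lambda>i\<in>?B. f i - 1) i) = (\<Sum>i\<in>?B. Suc (f i - 1))"
      by (simp only: sum_Suc) (simp add: add.commute)
    also have "\<dots> = (\<Sum>i\<in>A. f i)"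
      using A by (intro sum.mono_neutral_cong_left) auto
    finally show "(case ?down f of (B, g) \<Rightarrow> \<phi> (card B + (\<Sum>i\<in>B. g i))) = \<phi> (\<Sum>i\<in>A. f i)"
      by simp
  next
    fix x assume x: "x \<in> Sigma (Pow A) (\<lambda>B. parking_maps B s)"
    obtain B g where [simp]: "x = (B, g)" by (cases x)
    have B: "B \<subseteq> A" and g: "g \<in> extensional B" "parks B s g"
      using x by (auto simp: parking_maps_def PiE_def)
    have pos: "{i \<in> A. 0 < ?up x i} = B"
      using B by auto
    show "?down (?up x) = x"
      unfolding pos using B g by (auto simp: extensional_def fun_eq_iff)
    have "parks B s (\<lambda>i. ?up x i - 1)"
      using g(2) B by (subst parks_cong[where g = g]) auto
    then have "parks A (Suc s) (?up x)"
      unfolding parks_Suc_iff[OF A] pos .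
    then show "?up x \<in> parking_maps A (Suc s)"
      by (simp add: parking_maps_def)
  qed
  also have "\<dots> = (\<Sum>B\<in>Pow A. \<Sum>g\<in>parking_maps B s. \<phi> (card B + (\<Sum>i\<in>B. g i)))"
    using A by (subst sum.Sigma) (auto intro: finite_parking_maps finite_subset)
  finally show ?thesis .
qed

definition total_moment :: "nat \<Rightarrow> 'a set \<Rightarrow> nat \<Rightarrow> real" where
  "total_moment k A s = (\<Sum>f\<in>parking_maps A s. real (\<Sum>i\<in>A. f i) ^ k)"

lemma total_moment_Suc:
  assumes "finite A" "card A \<le> s"
  shows "total_moment 0 A (Suc s) = (\<Sum>B\<in>Pow A. total_moment 0 B s)"
    and "total_moment 1 A (Suc s) =
      (\<Sum>B\<in>Pow A. real (card B) * total_moment 0 B s + total_moment 1 B s)"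
    and "total_moment 2 A (Suc s) =
      (\<Sum>B\<in>Pow A. real (card B) * (real (card B) * total_moment 0 B s)
        + 2 * (real (card B) * total_moment 1 B s) + total_moment 2 B s)"
proof -
  have *: "total_moment k A (Suc s) =
      (\<Sum>B\<in>Pow A. \<Sum>g\<in>parking_maps B s. (real (card B) + real (\<Sum>i\<in>B. g i)) ^ k)" for k
    unfolding total_moment_def using sum_parking_maps_Suc[OF assms, of "\<lambda>t. real t ^ k"] by simp
  show "total_moment 0 A (Suc s) = (\<Sum>B\<in>Pow A. total_moment 0 B s)"
    unfolding * by (simp add: total_moment_def)
  show "total_moment 1 A (Suc s) =
      (\<Sum>B\<in>Pow A. real (card B) * total_moment 0 B s + total_moment 1 B s)"
    unfolding * by (simp add: total_moment_def sum.distrib mult.commute)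
  show "total_moment 2 A (Suc s) =
      (\<Sum>B\<in>Pow A. real (card B) * (real (card B) * total_moment 0 B s)
        + 2 * (real (card B) * total_moment 1 B s) + total_moment 2 B s)"
    unfolding *
    unfolding total_moment_def
    by (intro sum.cong refl)
      (simp add: power2_sum sum.distrib mult.assoc del: of_nat_sum flip: sum_distrib_left,
        simp add: power2_eq_square)
qed

section \<open>Coefficients of exponential generating functions\<close>

definition geo :: "real fps" where "geo = inverse (1 - fps_X)"

definition one_minus_X :: "real fps" where "one_minus_X = 1 - fps_X"

lemma fps_X_eq: "fps_X = 1 - one_minus_X"
  by (simp add: one_minus_X_def)

lemma geo_cancel:
  "geo * one_minus_X = 1" "one_minus_X * geo = 1"
  "geo * (one_minus_X * t) = t" "one_minus_X * (geo * t) = t"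
proof -
  show *: "geo * one_minus_X = 1"
    unfolding geo_def one_minus_X_def by (rule inverse_mult_eq_1) simp
  then show "one_minus_X * geo = 1" by (simp add: mult.commute)
  then show "geo * (one_minus_X * t) = t" "one_minus_X * (geo * t) = t"
    using * by (simp_all flip: mult.assoc)
qed

text \<open>Eliminating \<open>x\<close> in favour of \<open>1 - x\<close> makes every product of \<open>x\<close> with powers of \<open>1 / (1 - x)\<close> collapse to a
  Laurent polynomial in \<open>1 - x\<close>, which is a normal form.\<close>

lemmas geo_normalize = fps_X_eq geo_cancel eval_nat_numeral algebra_simps

lemma deriv_geo: "fps_deriv geo = geo\<^sup>2"
  unfolding geo_def by (subst fps_inverse_deriv) simp_all

lemma deriv_powers:
  "fps_deriv (geo\<^sup>2) = 2 * geo ^ 3"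
  "fps_deriv (geo ^ 3) = 3 * geo ^ 4"
  "fps_deriv (geo ^ 4) = 4 * geo ^ 5"
  "fps_deriv ((1 - fps_X :: real fps)\<^sup>2) = - 2 * (1 - fps_X)"
  "fps_deriv ((fps_X :: real fps)\<^sup>2) = 2 * fps_X"
  by (simp_all add: deriv_geo eval_nat_numeral algebra_simps)

definition euler :: "real fps \<Rightarrow> real fps" where
  "euler F = fps_X * fps_deriv F"

definition egf_coeff :: "nat \<Rightarrow> real fps \<Rightarrow> real" where
  "egf_coeff n F = fact n * fps_nth F n"

lemma egf_coeff_linear:
  "egf_coeff n (F + G) = egf_coeff n F + egf_coeff n G"
  "egf_coeff n (F - G) = egf_coeff n F - egf_coeff n G"
  "egf_coeff n (fps_const c * F) = c * egf_coeff n F"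
  "egf_coeff n (numeral w * F) = numeral w * egf_coeff n F"
  by (simp_all add: egf_coeff_def distrib_left right_diff_distrib numeral_fps_const)

lemma egf_coeff_euler: "egf_coeff n (euler F) = real n * egf_coeff n F"
  by (cases n) (simp_all add: egf_coeff_def euler_def)

text \<open>The series is \<open>(x d/dx - n)\<close> applied to \<open>e\<^sup>s\<^sup>x g\<close>, which has no term in \<open>x\<^sup>n\<close>. Every
  linear relation between coefficients used below arises from a choice of \<open>g\<close>.\<close>

lemma egf_coeff_exp_derivation:
  "egf_coeff n (fps_exp (real s) * ((of_nat s * fps_X - of_nat n) * g + euler g)) = 0"
proof -
  have "fps_exp (real s) * ((of_nat s * fps_X - of_nat n) * g + euler g)
      = euler (fps_exp (real s) * g) - fps_const (real n) * (fps_exp (real s) * g)"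
    by (simp add: euler_def fps_of_nat algebra_simps)
  then show ?thesis
    by (simp only: egf_coeff_linear egf_coeff_euler)
qed

lemma sum_Pow_card:
  fixes F :: "nat \<Rightarrow> real"
  assumes "finite A"
  shows "(\<Sum>B\<in>Pow A. F (card B)) = (\<Sum>m\<le>card A. real (card A choose m) * F m)"
proof -
  have "(\<Sum>B\<in>Pow A. F (card B)) = (\<Sum>m\<le>card A. \<Sum>B\<in>{B \<in> Pow A. card B = m}. F (card B))"
    by (rule sum.group[symmetric]) (use assms in \<open>auto intro: card_mono\<close>)
  also have "\<dots> = (\<Sum>m\<le>card A. real (card A choose m) * F m)"
    by (rule sum.cong) (simp_all add: n_subsets[OF assms, symmetric])
  finally show ?thesis .
qed

text \<open>Summing over all subsets is binomial convolution with the constant sequence 1, hence multiplication by \<open>e\<^sup>x\<close>.\<close>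

lemma sum_Pow_egf_coeff:
  assumes "finite A"
  shows "(\<Sum>B\<in>Pow A. egf_coeff (card B) F) = egf_coeff (card A) (fps_exp 1 * F)"
proof -
  let ?n = "card A"
  have "egf_coeff ?n (fps_exp 1 * F) = egf_coeff ?n (F * fps_exp 1)"
    by (simp add: mult.commute)
  also have "\<dots> = (\<Sum>m\<le>?n. fact ?n * (fps_nth F m * (1 / fact (?n - m))))"
    by (simp add: egf_coeff_def fps_mult_nth sum_distrib_left atLeast0AtMost)
  also have "\<dots> = (\<Sum>m\<le>?n. real (?n choose m) * egf_coeff m F)"
    by (rule sum.cong) (simp_all add: egf_coeff_def binomial_fact)
  finally show ?thesis
    using sum_Pow_card[OF assms, of "\<lambda>m. egf_coeff m F"] by simp
qed

section \<open>Closed forms for the moments\<close>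

text \<open>Write \<open>w = (1 - x) + t w\<^sub>1 + t\<^sup>2/2 w\<^sub>2 + \<dots>\<close>. The coefficients of \<open>t\<close> and of \<open>t\<^sup>2/2\<close> in
  \<open>exp(x (1 + e\<^sup>t + \<dots> + e\<^sup>(\<^sup>s\<^sup>-\<^sup>1\<^sup>)\<^sup>t)) w(e\<^sup>s\<^sup>t x, t)\<close> are \<open>e\<^sup>s\<^sup>x\<close> times rational functions; the following two series
  are these functions, multiplied by 2 and by 12 to clear denominators. Vanishing on the diagonal forces
  \<open>2 w\<^sub>1 = x / (1 - x)\<^sup>2 + x\<close>, and \<open>12 w\<^sub>2\<close> is the last line of the second definition.\<close>

definition egf1_factor :: "nat \<Rightarrow> real fps" where
  "egf1_factor s = of_nat s * (of_nat s - 1) * fps_X * (1 - fps_X) - 2 * of_nat s * fps_X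
     + fps_X * geo\<^sup>2 + fps_X"

definition egf2_factor :: "nat \<Rightarrow> real fps" where
  "egf2_factor s = (2 * of_nat s * (of_nat s - 1) * (2 * of_nat s - 1) * fps_X
        + 3 * (of_nat s)\<^sup>2 * (of_nat s - 1)\<^sup>2 * fps_X\<^sup>2) * (1 - fps_X)
     + 6 * of_nat s * (of_nat s - 1) * fps_X * (fps_X * geo\<^sup>2 + fps_X - 2 * of_nat s * fps_X)
     - 12 * (of_nat s)\<^sup>2 * fps_X
     + 12 * of_nat s * fps_X * (geo\<^sup>2 + 2 * fps_X * geo^3 + 1)
     - 48 * geo^5 + 108 * geo^4 - 88 * geo^3 + 34 * geo\<^sup>2 - 6 * geo - 2 * fps_X"

definition egf0 :: "nat \<Rightarrow> real fps" where "egf0 s = fps_exp (real s) * (1 - fps_X)"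
definition egf1 :: "nat \<Rightarrow> real fps" where "egf1 s = fps_exp (real s) * egf1_factor s"
definition egf2 :: "nat \<Rightarrow> real fps" where "egf2 s = fps_exp (real s) * egf2_factor s"

lemma euler_exp_mult:
  "euler (fps_exp (real s) * r) = fps_exp (real s) * (of_nat s * fps_X * r + euler r)"
  by (simp add: euler_def fps_of_nat algebra_simps)

lemma fps_exp_Suc: "fps_exp (real (Suc s)) = (fps_exp 1 * fps_exp (real s) :: real fps)"
  by (simp add: fps_exp_add_mult)

text \<open>The next three lemmas are the orders 0, 1, 2 in \<open>t\<close>, scaled by 1, 2, 12, of \<open>F\<^sub>s\<^sub>+\<^sub>1(x, t) = e\<^sup>x F\<^sub>s(e\<^sup>t x, t)\<close>, since
  \<open>F(e\<^sup>t x) = F + t x F' + t\<^sup>2/2 x (x F')' + \<dots>\<close>.\<close>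

lemma egf0_Suc: "egf0 (Suc s) = fps_exp 1 * egf0 s"
  unfolding egf0_def fps_exp_Suc by (simp add: mult.assoc)

lemma egf1_Suc: "egf1 (Suc s) = fps_exp 1 * (egf1 s + 2 * euler (egf0 s))"
proof -
  have "egf1_factor (Suc s) = egf1_factor s + 2 * (of_nat s * fps_X * (1 - fps_X) + euler (1 - fps_X))"
    by (simp add: egf1_factor_def euler_def algebra_simps)
  then show ?thesis
    unfolding egf1_def egf0_def euler_exp_mult fps_exp_Suc by (simp only: distrib_left mult_ac)
qed

lemma egf2_Suc:
  "egf2 (Suc s) = fps_exp 1 * (egf2 s + 12 * euler (egf1 s) + 12 * euler (euler (egf0 s)))"
proof -
  let ?u = "of_nat s * fps_X * (1 - fps_X) + euler (1 - fps_X)"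
  have "egf2_factor (Suc s) = egf2_factor s + 12 * (of_nat s * fps_X * egf1_factor s + euler (egf1_factor s))
     + 12 * (of_nat s * fps_X * ?u + euler ?u)"
    by (simp add: egf1_factor_def egf2_factor_def euler_def deriv_powers) (simp add: geo_normalize)
  then show ?thesis
    unfolding egf2_def egf1_def egf0_def euler_exp_mult fps_exp_Suc by (simp only: distrib_left mult_ac)
qed

text \<open>There are no parking maps with \<open>card A = s \<ge> 1\<close>, so the closed forms can only be right if they vanish there.
  Each part exhibits a \<open>g\<close> for \<open>egf_coeff_exp_derivation\<close> with \<open>s = n\<close>. For a Laurent polynomial
  \<open>g\<close> in \<open>1 - x\<close> over \<open>\<rat>[n]\<close> the required identity is a system of linear equations for the coefficients, and
  the series below are its solutions.\<close>

lemma egf_coeff_boundary: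
  assumes "n \<ge> 1"
  shows "egf_coeff n (egf0 n) = 0" "egf_coeff n (egf1 n) = 0" "egf_coeff n (egf2 n) = 0"
proof -
  have *: "egf_coeff n (fps_exp (real n) * r) = 0"
    if "c \<noteq> 0" "fps_const c * r = (of_nat n * fps_X - of_nat n) * g + euler g" for c r g
  proof -
    have "c * egf_coeff n (fps_exp (real n) * r) = 
        egf_coeff n (fps_exp (real n) * (fps_const c * r))"
      by (simp add: mult.left_commute flip: egf_coeff_linear(3))
    also have "\<dots> = 0" unfolding that(2) by (rule egf_coeff_exp_derivation)
    finally show ?thesis using that(1) by simp
  qed
  show "egf_coeff n (egf0 n) = 0"
    unfolding egf0_def
    by (rule *[where c = "real n" and g = "-1"])
      (use assms in \<open>simp_all add: euler_def fps_of_nat algebra_simps\<close>)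
  show "egf_coeff n (egf1 n) = 0"
    unfolding egf1_def
  proof (rule *[where c = 1 and g = "geo - (1 - fps_X) - of_nat n * fps_X"])
    show "fps_const 1 * egf1_factor n = (of_nat n * fps_X - of_nat n) * (geo - (1 - fps_X) - of_nat n * fps_X)
        + euler (geo - (1 - fps_X) - of_nat n * fps_X)"
      by (simp add: egf1_factor_def euler_def deriv_geo) (simp add: geo_normalize)
  qed simp
  let ?g = "- 12 * geo^4 + 20 * geo^3 - 14 * geo\<^sup>2 + 6 * geo - 2 * fps_X 
    + of_nat n * (6 * geo\<^sup>2 - 10 * geo + 13 - 6 * (1-fps_X) - 3 * (1-fps_X)\<^sup>2)
    + (of_nat n)\<^sup>2 * (6 * geo - 10 - 2 * (1-fps_X) + 6 * (1-fps_X)\<^sup>2)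
    - 3 * (of_nat n)^3 * fps_X\<^sup>2"
  show "egf_coeff n (egf2 n) = 0"
    unfolding egf2_def
  proof (rule *[where c = 1 and g = ?g])
    show "fps_const 1 * egf2_factor n = (of_nat n * fps_X - of_nat n) * ?g + euler ?g"
      by (simp add: egf2_factor_def euler_def deriv_geo deriv_powers) (simp add: geo_normalize)
  qed simp
qed

text \<open>Both sides satisfy the same recursion in \<open>s\<close>. It applies only while \<open>card A \<le> s\<close>; the remaining
  case \<open>card A = s + 1\<close> of the induction step is the diagonal, where both sides are zero.\<close>

lemma total_moment_eq_egf_coeff:
  assumes "finite A" "card A \<le> s"
  shows "total_moment 0 A s = egf_coeff (card A) (egf0 s)
    \<and> 2 * total_moment 1 A s = egf_coeff (card A) (egf1 s)
    \<and> 12 * total_moment 2 A s = egf_coeff (card A) (egf2 s)"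
  using assms
proof (induction s arbitrary: A)
  case 0
  then have "A = {}" by simp
  moreover have "fps_nth geo 0 = 1" by (simp add: geo_def)
  ultimately show ?case
    by (simp add: total_moment_def parking_maps_empty egf_coeff_def egf0_def egf1_def egf2_def
        egf1_factor_def egf2_factor_def fps_power_zeroth)
next
  case (Suc s)
  show ?case
  proof (cases "card A = Suc s")
    case True
    then have "A \<noteq> {}" by auto
    then have "parking_maps A (Suc s) = {}"
      using parking_maps_diagonal[OF Suc.prems(1)] True by simp
    then show ?thesis
      using egf_coeff_boundary[of "Suc s"] by (simp add: total_moment_def True)
  next
    case False
    then have A: "card A \<le> s" using Suc.prems by simp
    have B: "total_moment 0 B s = egf_coeff (card B) (egf0 s)"
      "2 * total_moment 1 B s = egf_coeff (card B) (egf1 s)"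
      "12 * total_moment 2 B s = egf_coeff (card B) (egf2 s)" if "B \<in> Pow A" for B
    proof -
      have "finite B" "card B \<le> s"
        using that A Suc.prems(1) by (auto intro: finite_subset dest: card_mono order_trans)
      then show "total_moment 0 B s = egf_coeff (card B) (egf0 s)"
        "2 * total_moment 1 B s = egf_coeff (card B) (egf1 s)"
        "12 * total_moment 2 B s = egf_coeff (card B) (egf2 s)"
        using Suc.IH by blast+
    qed
    have "total_moment 0 A (Suc s) = (\<Sum>B\<in>Pow A. egf_coeff (card B) (egf0 s))"
      unfolding total_moment_Suc(1)[OF Suc.prems(1) A] by (intro sum.cong refl B)
    moreover have "2 * total_moment 1 A (Suc s) =
        (\<Sum>B\<in>Pow A. egf_coeff (card B) (egf1 s + 2 * euler (egf0 s)))"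
      unfolding total_moment_Suc(2)[OF Suc.prems(1) A] sum_distrib_left
    proof (intro sum.cong refl)
      fix B assume "B \<in> Pow A"
      from B[OF this] show "2 * (real (card B) * total_moment 0 B s + total_moment 1 B s) =
          egf_coeff (card B) (egf1 s + 2 * euler (egf0 s))"
        by (simp add: egf_coeff_linear egf_coeff_euler)
    qed
    moreover have "12 * total_moment 2 A (Suc s) =
        (\<Sum>B\<in>Pow A. egf_coeff (card B) (egf2 s + 12 * euler (egf1 s) + 12 * euler (euler (egf0 s))))"
      unfolding total_moment_Suc(3)[OF Suc.prems(1) A] sum_distrib_left
    proof (intro sum.cong refl)
      fix B assume "B \<in> Pow A"
      note B = B[OF this]
      show "12 * (real (card B) * (real (card B) * total_moment 0 B s)
          + 2 * (real (card B) * total_moment 1 B s) + total_moment 2 B s) =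
          egf_coeff (card B) (egf2 s + 12 * euler (egf1 s) + 12 * euler (euler (egf0 s)))"
        by (simp add: egf_coeff_linear egf_coeff_euler B(1) flip: B(2,3))
    qed
    ultimately show ?thesis
      by (simp only: sum_Pow_egf_coeff[OF Suc.prems(1)] egf0_Suc egf1_Suc egf2_Suc)
  qed
qed

section \<open>Parking functions as parking maps\<close>

text \<open>If the entry at the sorted position \<open>i\<close> is too large, then so are all entries after it, which violates the counting
  condition for \<open>j = n - i\<close>. Conversely, under the sorted bounds only the last \<open>j - 1\<close> positions can be counted.\<close>

lemma sort_bound_iff_parks:
  fixes p :: "nat list"
  defines "n \<equiv> length p"
  assumes "\<forall>i<n. 1 \<le> p ! i"
  shows "(\<forall>i<n. sort p ! i \<le> Suc i) \<longleftrightarrow> parks {..<n} (Suc n) (\<lambda>i. p ! i - 1)"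
proof -
  let ?q = "sort p"
  have len: "length ?q = n" by (simp add: n_def)
  have count: "card {i \<in> {..<n}. Suc n \<le> p ! i - 1 + j} = card {i. i < n \<and> n + 2 \<le> ?q ! i + j}" for j
  proof -
    have "{i \<in> {..<n}. Suc n \<le> p ! i - 1 + j} = {i. i < length p \<and> n + 2 \<le> p ! i + j}"
      using assms(2) by (fastforce simp: n_def)
    also have "card \<dots> = length (filter (\<lambda>v. n + 2 \<le> v + j) p)"
      by (simp add: length_filter_conv_card)
    also have "\<dots> = length (filter (\<lambda>v. n + 2 \<le> v + j) ?q)"
      by (metis filter_sort length_sort)
    finally show ?thesis by (simp add: length_filter_conv_card n_def)
  qed
  show ?thesis
  proof
    assume le: "\<forall>i<n. ?q ! i \<le> Suc i"
    have "card {i. i < n \<and> n + 2 \<le> ?q ! i + j} < j" if "j \<ge> 1" for j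
    proof -
      have "{i. i < n \<and> n + 2 \<le> ?q ! i + j} \<subseteq> {Suc n - j..<n}"
      proof
        fix i assume "i \<in> {i. i < n \<and> n + 2 \<le> ?q ! i + j}"
        then have "i < n" "n + 2 \<le> ?q ! i + j" "?q ! i \<le> Suc i" using le by auto
        then have "i < n" "Suc n \<le> i + j" by linarith+
        then show "i \<in> {Suc n - j..<n}" by simp
      qed
      then have "card {i. i < n \<and> n + 2 \<le> ?q ! i + j} \<le> card {Suc n - j..<n}"
        by (intro card_mono) auto
      also have "\<dots> < j" using that by simp
      finally show ?thesis .
    qed
    then show "parks {..<n} (Suc n) (\<lambda>i. p ! i - 1)"
      unfolding parks_def count by blast
  next
    assume pk: "parks {..<n} (Suc n) (\<lambda>i. p ! i - 1)"
    show "\<forall>i<n. ?q ! i \<le> Suc i"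
    proof (intro allI impI, rule ccontr)
      fix i assume i: "i < n" "\<not> ?q ! i \<le> Suc i"
      have "{i..<n} \<subseteq> {k. k < n \<and> n + 2 \<le> ?q ! k + (n - i)}"
      proof
        fix k assume k: "k \<in> {i..<n}"
        then have "?q ! i \<le> ?q ! k" by (intro sorted_nth_mono) (auto simp: n_def)
        then show "k \<in> {k. k < n \<and> n + 2 \<le> ?q ! k + (n - i)}" using i k by simp
      qed
      then have "card {i..<n} \<le> card {k. k < n \<and> n + 2 \<le> ?q ! k + (n - i)}"
        by (intro card_mono) auto
      moreover have "card {k. k < n \<and> n + 2 \<le> ?q ! k + (n - i)} < n - i"
        using pk[unfolded parks_def count, rule_format, of "n - i"] i(1) by linarith
      ultimately show False unfolding card_atLeastLessThan by linarith
    qed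
  qed
qed

lemma sum_parking_functions:
  fixes \<psi> :: "real \<Rightarrow> real"
  shows "(\<Sum>p\<in>parking_functions n. \<psi> (area p)) =
    (\<Sum>f\<in>parking_maps {..<n} (Suc n). \<psi> (real n * (real n - 1) / 2 - real (\<Sum>i<n. f i)))"
proof (rule sum.reindex_bij_witness[where i = "\<lambda>f. map (\<lambda>i. Suc (f i)) [0..<n]"
      and j = "\<lambda>p. \<lambda>i\<in>{..<n}. p ! i - 1"])
  fix p assume p: "p \<in> parking_functions n"
  then have len: "length p = n" and pos: "\<forall>i<n. 1 \<le> p ! i" and "\<forall>i<n. sort p ! i \<le> Suc i"
    by (auto simp: parking_functions_def)
  then show "map (\<lambda>i. Suc ((\<lambda>i\<in>{..<n}. p ! i - 1) i)) [0..<n] = p"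
    by (intro nth_equalityI) auto
  have "parks {..<n} (Suc n) (\<lambda>i. p ! i - 1)"
    using sort_bound_iff_parks[of p] len pos \<open>\<forall>i<n. sort p ! i \<le> Suc i\<close> by simp
  then show "(\<lambda>i\<in>{..<n}. p ! i - 1) \<in> parking_maps {..<n} (Suc n)"
    unfolding parking_maps_def by (subst (asm) parks_cong[where g = "\<lambda>i\<in>{..<n}. p ! i - 1"]) auto
  have "(\<Sum>i<n. real (p ! i)) = (\<Sum>i<n. real (p ! i - 1) + 1)"
    by (rule sum.cong) (use pos in \<open>auto simp: of_nat_diff\<close>)
  also have "\<dots> = real (\<Sum>i<n. p ! i - 1) + real n"
    by (simp add: sum.distrib)
  finally have "area p = real n * (real n - 1) / 2 - real (\<Sum>i<n. p ! i - 1)"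
    by (simp add: area_def len field_simps)
  then show "\<psi> (real n * (real n - 1) / 2 - real (\<Sum>i<n. (\<lambda>i\<in>{..<n}. p ! i - 1) i)) = \<psi> (area p)"
    by simp
next
  fix f assume f: "f \<in> parking_maps {..<n} (Suc n)"
  let ?p = "map (\<lambda>i. Suc (f i)) [0..<n]"
  have ext: "f \<in> extensional {..<n}" and pk: "parks {..<n} (Suc n) f"
    using f by (auto simp: parking_maps_def PiE_def)
  show "(\<lambda>i\<in>{..<n}. ?p ! i - 1) = f"
    using ext by (auto simp: extensional_def fun_eq_iff)
  have "parks {..<n} (Suc n) (\<lambda>i. ?p ! i - 1)"
    using pk by (subst parks_cong[where g = f]) auto
  then have "\<forall>i<n. sort ?p ! i \<le> Suc i"
    using sort_bound_iff_parks[of ?p] by simp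
  moreover have "f i < n" if "i < n" for i
    using parks_less[OF _ pk, of i] that by simp
  ultimately show "?p \<in> parking_functions n"
    by (auto simp: parking_functions_def Suc_le_eq)
qed

section \<open>The second factorial moment\<close>

text \<open>With \<open>D\<close> the total of a map and \<open>N = n (n - 1) / 2\<close>, the area is \<open>N - D\<close>. Expressing the exact formula through the
  moments of \<open>D\<close>, bringing everything to one side and multiplying by 12 gives \<open>12 E[D\<^sup>2] + 2 a E[D] + b = 0\<close>. As in
  \<open>egf_coeff_boundary\<close>, the relation holds because of a suitable \<open>g\<close>, now for \<open>s = n + 1\<close>.\<close>

lemma moment_relation:
  fixes n :: nat
  defines "a \<equiv> - 6 * real n * (real n - 1) + 6 - 14 * (real n + 1)"
    and "b \<equiv> 3 * (real n)\<^sup>2 * (real n - 1)\<^sup>2 - 6 * real n * (real n - 1)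
          + 14 * real n * (real n - 1) * (real n + 1) - (5 * real n ^ 3 - (real n)\<^sup>2 - 4 * real n)"
  shows "egf_coeff n (egf2 (Suc n)) + a * egf_coeff n (egf1 (Suc n)) + b * egf_coeff n (egf0 (Suc n)) = 0"
proof -
  let ?N = "of_nat n :: real fps"
  let ?g = "- 12 * geo ^ 4 + 24 * geo ^ 3 - 14 * geo\<^sup>2 + 6 + ?N * (6 * geo\<^sup>2 - 8 * geo + 4)
    + ?N\<^sup>2 * (- 5 + 5 * (1 - fps_X) - 3 * (1 - fps_X)\<^sup>2) - 3 * ?N ^ 3 * (1 - fps_X)\<^sup>2"
  have const: "fps_const a = - 6 * ?N * (?N - 1) + 6 - 14 * (?N + 1)"
    "fps_const b = 3 * ?N\<^sup>2 * (?N - 1)\<^sup>2 - 6 * ?N * (?N - 1)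
          + 14 * ?N * (?N - 1) * (?N + 1) - (5 * ?N ^ 3 - ?N\<^sup>2 - 4 * ?N)"
    unfolding a_def b_def
    by (simp_all only: fps_of_nat fps_const_1_eq_1
        flip: fps_const_add fps_const_sub fps_const_mult fps_const_power fps_const_neg numeral_fps_const)
  have "egf2_factor (Suc n) + fps_const a * egf1_factor (Suc n) + fps_const b * (1 - fps_X) =
      (of_nat (Suc n) * fps_X - of_nat n) * ?g + euler ?g"
    unfolding const
    by (simp add: egf1_factor_def egf2_factor_def euler_def deriv_geo deriv_powers) (simp add: geo_normalize)
  then have "egf_coeff n (fps_exp (real (Suc n)) *
      (egf2_factor (Suc n) + fps_const a * egf1_factor (Suc n) + fps_const b * (1 - fps_X))) = 0"
    by (simp only: egf_coeff_exp_derivation)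
  then show ?thesis
    by (simp only: egf0_def egf1_def egf2_def distrib_left mult.left_commute[of _ "fps_const _"]
        egf_coeff_linear)
qed

lemma expectation_parking_functions:
  "measure_pmf.expectation (pmf_of_set (parking_functions n)) h =
    (\<Sum>p\<in>parking_functions n. h p) / real (card (parking_functions n))"
  by (rule integral_pmf_of_set[OF parking_functions_nonempty finite_parking_functions])

lemma area_factorial_moment_2:
  "area_factorial_moment 2 n = (\<Sum>p\<in>parking_functions n. area p * (area p - 1)) /
     real (card (parking_functions n))"
  by (simp add: area_factorial_moment_def expectation_parking_functions numeral_2_eq_2)

lemma second_factorial_moment:
  "area_factorial_moment 2 n =
     - (7 / 3) * (real n + 1) * area_expectation n
     + 5 / 12 * real n ^ 3 - 1 / 12 * real n ^ 2 - 1 / 3 * real n"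
proof -
  define N where "N = real n * (real n - 1) / 2"
  let ?M = "\<lambda>k. total_moment k {..<n} (Suc n)"
  let ?c = "real (card (parking_functions n))"
  have c_pos: "?c > 0"
    using finite_parking_functions parking_functions_nonempty by (simp add: card_gt_0_iff)
  have c: "?c = ?M 0"
    using sum_parking_functions[of "\<lambda>_. 1"] by (simp add: total_moment_def)
  have S1: "(\<Sum>p\<in>parking_functions n. area p) = N * ?M 0 - ?M 1"
    unfolding sum_parking_functions[of "\<lambda>x. x"]
    by (simp add: total_moment_def N_def sum_subtractf)
  have S2: "(\<Sum>p\<in>parking_functions n. area p * (area p - 1)) =
      ?M 2 - (2 * N - 1) * ?M 1 + (N\<^sup>2 - N) * ?M 0"
    unfolding sum_parking_functions[of "\<lambda>x. x * (x - 1)"] total_moment_def N_def[symmetric]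
      sum_distrib_left sum_subtractf[symmetric] sum.distrib[symmetric]
    by (intro sum.cong refl) (simp add: power2_eq_square algebra_simps)
  have M: "?M 0 = egf_coeff n (egf0 (Suc n))" "2 * ?M 1 = egf_coeff n (egf1 (Suc n))"
    "12 * ?M 2 = egf_coeff n (egf2 (Suc n))"
    using total_moment_eq_egf_coeff[of "{..<n}" "Suc n"] by auto
  have "12 * (?M 2 - (2 * N - 1) * ?M 1 + (N\<^sup>2 - N) * ?M 0) =
      - 28 * (real n + 1) * (N * ?M 0 - ?M 1) + (5 * real n ^ 3 - (real n)\<^sup>2 - 4 * real n) * ?M 0"
    using moment_relation[of n] unfolding M[symmetric] N_def
    by (simp add: field_simps eval_nat_numeral)
  then have "12 * (\<Sum>p\<in>parking_functions n. area p * (area p - 1)) =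
      - 28 * (real n + 1) * (\<Sum>p\<in>parking_functions n. area p)
      + (5 * real n ^ 3 - (real n)\<^sup>2 - 4 * real n) * ?c"
    by (simp only: S1 S2 c)
  then show ?thesis
    using c_pos
    unfolding area_factorial_moment_2 area_expectation_def expectation_parking_functions
    by (simp add: field_simps)
qed

section \<open>The order of the expectation\<close>

lemma area_nonneg:
  assumes "p \<in> parking_functions n"
  shows "area p \<ge> 0"
proof -
  have len: "length p = n" and le: "\<forall>i<n. sort p ! i \<le> Suc i"
    using assms by (auto simp: parking_functions_def)
  have "(\<Sum>i<n. p ! i) = sum_list p"
    by (simp add: sum_list_sum_nth len atLeast0LessThan)
  also have "\<dots> = sum_list (sort p)"
    by (metis mset_sort sum_mset_sum_list)
  also have "\<dots> = (\<Sum>i<n. sort p ! i)"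
    by (simp add: sum_list_sum_nth len atLeast0LessThan)
  also have "\<dots> \<le> (\<Sum>i<n. Suc i)"
    using le by (intro sum_mono) auto
  finally have "real (\<Sum>i<n. p ! i) \<le> real (\<Sum>i<n. Suc i)"
    by (simp only: of_nat_le_iff)
  also have "\<dots> = real n * (real n + 1) / 2"
    by (induction n) (simp_all add: field_simps)
  finally show ?thesis by (simp add: area_def len)
qed

lemma area_expectation_nonneg: "area_expectation n \<ge> 0"
  unfolding area_expectation_def expectation_parking_functions
  by (intro divide_nonneg_nonneg sum_nonneg area_nonneg) auto

text \<open>The second moment is at least \<open>E\<^sub>1(n)\<^sup>2\<close> and, since \<open>E\<^sub>1(n) \<ge> 0\<close> enters the exact formula with a negative
  coefficient, at most \<open>5/12 n\<^sup>3\<close>.\<close>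

lemma area_expectation_le_powr:
  assumes "n \<ge> 1"
  shows "area_expectation n \<le> real n powr (3 / 2)"
proof -
  let ?P = "parking_functions n" and ?E = "area_expectation n"
  let ?c = "real (card ?P)" and ?S = "\<Sum>p\<in>?P. area p" and ?Q = "\<Sum>p\<in>?P. (area p)\<^sup>2"
  have c_pos: "?c > 0"
    using finite_parking_functions parking_functions_nonempty by (simp add: card_gt_0_iff)
  have "?S\<^sup>2 \<le> ?c * ?Q"
    using sum_squared_le_sum_of_squares[of area ?P] finite_parking_functions by (simp add: mult.commute)
  then have "(?S / ?c)\<^sup>2 \<le> ?Q / ?c"
    using c_pos by (simp add: power_divide field_simps power2_eq_square)
  moreover have "?Q / ?c = area_factorial_moment 2 n + ?E"
    unfolding area_factorial_moment_2 area_expectation_def expectation_parking_functions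
    by (simp add: power2_eq_square right_diff_distrib sum_subtractf flip: add_divide_distrib)
  ultimately have "?E\<^sup>2 \<le> area_factorial_moment 2 n + ?E"
    by (simp add: area_expectation_def expectation_parking_functions)
  also have "\<dots> = 5 / 12 * real n ^ 3 - (1 / 12 * (real n)\<^sup>2 + 1 / 3 * real n
      + (7 / 3 * (real n + 1) - 1) * ?E)"
    unfolding second_factorial_moment by (simp add: algebra_simps)
  also have "\<dots> \<le> 5 / 12 * real n ^ 3"
  proof -
    have "0 \<le> (7 / 3 * (real n + 1) - 1) * ?E"
      using area_expectation_nonneg by (intro mult_nonneg_nonneg) auto
    then have "0 \<le> 1 / 12 * (real n)\<^sup>2 + 1 / 3 * real n + (7 / 3 * (real n + 1) - 1) * ?E"
      by simp
    then show ?thesis by linarith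
  qed
  also have "\<dots> \<le> real n ^ 3" by simp
  also have "\<dots> = (real n powr (3 / 2))\<^sup>2"
    using assms by (simp add: power2_eq_square powr_numeral flip: powr_add)
  finally show ?thesis
    by (rule power2_le_imp_le) simp
qed

theorem theorem2p8:
  shows "(\<forall>n::nat. n \<ge> 1 \<longrightarrow>
            area_factorial_moment 2 n =
              - (7 / 3) * (real n + 1) * area_expectation n
              + 5 / 12 * real n ^ 3 - 1 / 12 * real n ^ 2 - 1 / 3 * real n)
       \<and> (\<lambda>n::nat. area_factorial_moment 2 n - 5 / 12 * real n ^ 3)
            \<in> O[at_top](\<lambda>n. real n powr (5 / 2))"
proof (intro conjI allI impI)
  show "area_factorial_moment 2 n =
      - (7 / 3) * (real n + 1) * area_expectation n
      + 5 / 12 * real n ^ 3 - 1 / 12 * real n ^ 2 - 1 / 3 * real n" for n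
    by (rule second_factorial_moment)
  have "norm (area_factorial_moment 2 n - 5 / 12 * real n ^ 3) \<le> 6 * norm (real n powr (5 / 2))"
    if n: "n \<ge> 1" for n
  proof -
    let ?R = "real n powr (5 / 2)"
    have "(real n + 1) * area_expectation n \<le> (2 * real n) * real n powr (3 / 2)"
      using n area_expectation_le_powr[OF n] area_expectation_nonneg
      by (intro mult_mono) auto
    also have "\<dots> = 2 * ?R"
      using n powr_add[of "real n" 1 "3 / 2"] by simp
    finally have "(real n + 1) * area_expectation n \<le> 2 * ?R" .
    moreover have "(real n + 1) * area_expectation n \<ge> 0"
      using area_expectation_nonneg by simp
    moreover have "(real n)\<^sup>2 \<le> ?R" "real n \<le> ?R"
      using n powr_mono[of 2 "5 / 2" "real n"] powr_mono[of 1 "5 / 2" "real n"]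
      by (simp_all add: powr_numeral)
    moreover have "area_factorial_moment 2 n - 5 / 12 * real n ^ 3 =
        - (7 / 3) * ((real n + 1) * area_expectation n) - 1 / 12 * (real n)\<^sup>2 - 1 / 3 * real n"
      unfolding second_factorial_moment by simp
    ultimately have "\<bar>area_factorial_moment 2 n - 5 / 12 * real n ^ 3\<bar> \<le> 6 * ?R"
      using zero_le_power2[of "real n"] of_nat_0_le_iff[of n, where ?'a = real] by linarith
    then show ?thesis by simp
  qed
  then show "(\<lambda>n. area_factorial_moment 2 n - 5 / 12 * real n ^ 3) \<in> O(\<lambda>n. real n powr (5 / 2))"
    by (intro bigoI[where c = 6] eventually_at_top_linorderI[of 1])
qed

end
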